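(* Let $n,s,r,r'$ be positive integers with $r\le r'\le\min(n,s)$, let $\mathbf V\in\mathbb R^{n\times s}$, and let $\mathbf U\in\mathbb R^{n\times r}$ and $\mathbf Y\in\mathbb R^{s\times r}$ have orthonormal columns, i.e. $\mathbf U^T\mathbf U=\mathbf I$ and $\mathbf Y^T\mathbf Y=\mathbf I$. Let $\mathbf p$ and $\mathbf s$ be vectors of $r'$ distinct row indices in $\{1,\dots,n\}$ and $r'$ distinct column indices in $\{1,\dots,s\}$, with indexing matrices $\mathbf P=\mathbf I_n(:,\mathbf p)\in\mathbb R^{n\times r'}$ and $\mathbf S=\mathbf I_s(:,\mathbf s)\in\mathbb R^{s\times r'}$, such that the $r\times r$ matrices $(\mathbf P^T\mathbf U)^T(\mathbf P^T\mathbf U)$ and $(\mathbf S^T\mathbf Y)^T(\mathbf S^T\mathbf Y)$ are invertible. Define the oblique projectors $$\mathbf P_{\mathbf U}^{\mathrm{obl}}=\mathbf U(\mathbf P^T\mathbf U)^{\dagger}\mathbf P^T,\qquad \mathbf P_{\mathbf Y}^{\mathrm{obl}}=\mathbf S(\mathbf Y^T\mathbf S)^{\dagger}\mathbf Y^T .$$ Let $\eta_p=\|(\mathbf P^T\mathbf U)^{\dagger}\|$, $\eta_s=\|(\mathbf S^T\mathbf Y)^{\dagger}\|$, let $\epsilon_f\ge 0$ be given by $$\epsilon_f=\min\{\eta_p(1+\eta_s),\ \eta_s(1+\eta_p)\}-1,$$ and let $$\hat\sigma_{r+1}=\max\{\|\mathbf V-\mathbf U\mathbf U^T\mathbf V\|,\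 \|\mathbf V-\mathbf V\mathbf Y\mathbf Y^T\|\}.$$ Then the error of the oblique projection is bounded by $$\|\mathbf V-\mathbf P_{\mathbf U}^{\mathrm{obl}}\,\mathbf V\,\mathbf P_{\mathbf Y}^{\mathrm{obl}}\|\le(1+\epsilon_f)\,\hat\sigma_{r+1}.$$
   Context: $\|\cdot\|$ is the matrix 2-norm (spectral norm). $(\cdot)^\dagger$ is the Moore–Penrose pseudoinverse. $\mathbf I_k$ is the $k\times k$ identity matrix, and $\mathbf I_n(:,\mathbf p)$ denotes the matrix formed by the columns of $\mathbf I_n$ listed in $\mathbf p$; thus $\mathbf P^T\mathbf U$ consists of the rows of $\mathbf U$ listed in $\mathbf p$ and $\mathbf S^T\mathbf Y$ of the rows of $\mathbf Y$ listed in $\mathbf s$. The integer $s$ (number of columns of $\mathbf V$) is distinct from the bold index vector $\mathbf s$. *)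

theory Defs
  imports "HOL-Analysis.Analysis"
begin

(* The spectral norm; the type-class norm on real^'b^'a is the Frobenius norm instead. *)
definition spectral_norm :: "real^'b^'a \<Rightarrow> real" where
  "spectral_norm A = onorm (\<lambda>x. A *v x)"

(* The four Penrose conditions; every real matrix has exactly one such X. *)
definition is_pinv :: "real^'b^'a \<Rightarrow> real^'a^'b \<Rightarrow> bool" where
  "is_pinv A X \<longleftrightarrow>
     A ** X ** A = A \<and> X ** A ** X = X \<and>
     transpose (A ** X) = A ** X \<and> transpose (X ** A) = X ** A"

definition pinv :: "real^'b^'a \<Rightarrow> real^'a^'b" where
  "pinv A = (THE X. is_pinv A X)"

(* A(:,p) *)
definition select_columns :: "real^'b^'a \<Rightarrow> ('q \<Rightarrow> 'b) \<Rightarrow> real^'q^'a" where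
  "select_columns A p = (\<chi> i j. A $ i $ p j)"

lemma is_pinv_unique:
  assumes "is_pinv A X" "is_pinv A Y"
  shows "X = Y"
proof -
  have x: "A ** X ** A = A" "X ** A ** X = X"
      "transpose (A ** X) = A ** X" "transpose (X ** A) = X ** A"
    and y: "A ** Y ** A = A" "Y ** A ** Y = Y"
      "transpose (A ** Y) = A ** Y" "transpose (Y ** A) = Y ** A"
    using assms by (auto simp: is_pinv_def)
  have "A ** X = (A ** Y) ** (A ** X)"
    by (metis y(1) matrix_mul_assoc)
  also have "\<dots> = transpose ((A ** X) ** (A ** Y))"
    by (subst matrix_transpose_mul) (simp only: x(3) y(3))
  also have "\<dots> = A ** Y"
    by (metis x(1) y(3) matrix_mul_assoc)
  finally have ax: "A ** X = A ** Y" .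
  have "X ** A = (X ** A) ** (Y ** A)"
    by (metis y(1) matrix_mul_assoc)
  also have "\<dots> = transpose ((Y ** A) ** (X ** A))"
    by (subst matrix_transpose_mul) (simp only: x(4) y(4))
  also have "\<dots> = Y ** A"
    by (metis x(1) y(4) matrix_mul_assoc)
  finally have xa: "X ** A = Y ** A" .
  show ?thesis
    by (metis ax xa x(2) y(2) matrix_mul_assoc)
qed

lemma pinv_eqI: "is_pinv A X \<Longrightarrow> pinv A = X"
  unfolding pinv_def by (blast intro: the_equality is_pinv_unique)

end

theory Submission
  imports Defs
begin

text \<open>
  Both oblique projectors are idempotent and nonzero, and a nonzero idempotent \<open>Q\<close> on a Euclidean
  space satisfies \<open>\<parallel>I - Q\<parallel> \<le> \<parallel>Q\<parallel>\<close>. Since \<open>I - P\<^sub>U\<close> annihilates the range of \<open>U\<close>, it can be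
  composed with \<open>I - U U\<^sup>T\<close> for free, so \<open>\<parallel>(I - P\<^sub>U) V\<parallel> \<le> \<eta>\<^sub>p \<sigma>\<close>; symmetrically
  \<open>\<parallel>V (I - P\<^sub>Y)\<parallel> \<le> \<eta>\<^sub>s \<sigma>\<close>. The two terms of the minimum arise from the two splittings
  \<open>V - P\<^sub>U V P\<^sub>Y = (I - P\<^sub>U) V + P\<^sub>U V (I - P\<^sub>Y) = V (I - P\<^sub>Y) + (I - P\<^sub>U) V P\<^sub>Y\<close>.
\<close>

lemma matrix_diff_ldistrib:
  fixes A :: "real^'b^'a" and B C :: "real^'c^'b"
  shows "A ** (B - C) = A ** B - A ** C"
  by (simp add: matrix_matrix_mult_def vec_eq_iff right_diff_distrib sum_subtractf)

lemma matrix_diff_rdistrib: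
  fixes A B :: "real^'b^'a" and C :: "real^'c^'b"
  shows "(A - B) ** C = A ** C - B ** C"
  by (simp add: matrix_matrix_mult_def vec_eq_iff left_diff_distrib sum_subtractf)

lemma norm_matrix_vector_mult_le:
  fixes A :: "real^'b^'a"
  shows "norm (A *v x) \<le> spectral_norm A * norm x"
  unfolding spectral_norm_def by (rule onorm) (rule matrix_vector_mul_bounded_linear)

lemma spectral_norm_leI:
  fixes A :: "real^'b^'a"
  assumes "\<And>x. norm (A *v x) \<le> c * norm x"
  shows "spectral_norm A \<le> c"
  unfolding spectral_norm_def using assms by (rule onorm_le)

lemma spectral_norm_nonneg: "0 \<le> spectral_norm A"
  unfolding spectral_norm_def by (rule onorm_pos_le) (rule matrix_vector_mul_bounded_linear)

lemma spectral_norm_mult_le: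
  fixes A :: "real^'b^'a" and B :: "real^'c^'b"
  shows "spectral_norm (A ** B) \<le> spectral_norm A * spectral_norm B"
proof (rule spectral_norm_leI)
  fix x :: "real^'c"
  have "norm (A *v (B *v x)) \<le> spectral_norm A * norm (B *v x)"
    by (rule norm_matrix_vector_mult_le)
  also have "\<dots> \<le> spectral_norm A * (spectral_norm B * norm x)"
    by (intro mult_left_mono norm_matrix_vector_mult_le spectral_norm_nonneg)
  finally show "norm (A ** B *v x) \<le> spectral_norm A * spectral_norm B * norm x"
    by (simp add: matrix_vector_mul_assoc)
qed

lemma spectral_norm_mult_le_mono:
  fixes A :: "real^'b^'a" and B :: "real^'c^'b"
  assumes "spectral_norm A \<le> a" "spectral_norm B \<le> b"
  shows "spectral_norm (A ** B) \<le> a * b"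
proof -
  have "spectral_norm A * spectral_norm B \<le> a * b"
    using assms spectral_norm_nonneg[of A] spectral_norm_nonneg[of B]
    by (intro mult_mono) auto
  then show ?thesis
    using spectral_norm_mult_le[of A B] by linarith
qed

lemma spectral_norm_triangle:
  fixes A B :: "real^'b^'a"
  shows "spectral_norm (A + B) \<le> spectral_norm A + spectral_norm B"
  unfolding spectral_norm_def matrix_vector_mult_add_rdistrib
  by (rule onorm_triangle) (rule matrix_vector_mul_bounded_linear)+

text \<open>Write the squared norm of \<open>transpose A *v x\<close> as an inner product of
  \<open>x\<close> with \<open>A *v (transpose A *v x)\<close>, apply Cauchy-Schwarz and cancel one
  factor.\<close>

lemma spectral_norm_transpose_le:
  fixes A :: "real^'b^'a"
  shows "spectral_norm (transpose A) \<le> spectral_norm A"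
proof (rule spectral_norm_leI)
  fix x :: "real^'a"
  let ?y = "transpose A *v x"
  have "norm ?y * norm ?y = ?y \<bullet> ?y"
    by (simp add: power2_norm_eq_inner flip: power2_eq_square)
  also have "\<dots> = x \<bullet> (A *v ?y)"
    by (simp add: dot_lmul_matrix)
  also have "\<dots> \<le> norm x * norm (A *v ?y)"
    by (rule norm_cauchy_schwarz)
  also have "\<dots> \<le> norm x * (spectral_norm A * norm ?y)"
    by (intro mult_left_mono norm_matrix_vector_mult_le) simp
  finally have "norm ?y * norm ?y \<le> (spectral_norm A * norm x) * norm ?y"
    by (simp add: mult_ac)
  then show "norm ?y \<le> spectral_norm A * norm x"
    using spectral_norm_nonneg[of A] by (cases "norm ?y = 0") auto
qed

lemma spectral_norm_transpose: "spectral_norm (transpose A) = spectral_norm A"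
  using spectral_norm_transpose_le[of A] spectral_norm_transpose_le[of "transpose A"] by simp

lemma norm_orthonormal_columns:
  fixes U :: "real^'r^'n"
  assumes "transpose U ** U = mat 1"
  shows "norm (U *v x) = norm x"
proof -
  have "(U *v x) \<bullet> (U *v x) = (transpose U *v (U *v x)) \<bullet> x"
    by (simp add: dot_lmul_matrix)
  also have "\<dots> = x \<bullet> x"
    using assms by (simp add: matrix_vector_mul_assoc del: transpose_matrix_vector)
  finally show ?thesis
    by (simp add: norm_eq)
qed

lemma spectral_norm_orthonormal_columns_le:
  assumes "transpose U ** U = mat 1"
  shows "spectral_norm U \<le> 1"
  by (rule spectral_norm_leI) (simp add: norm_orthonormal_columns[OF assms])

text \<open>Injectivity expresses that the indices are distinct, so the selected columns are
  distinct standard basis vectors.\<close>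

lemma select_columns_orthonormal:
  assumes "inj p"
  shows "transpose (select_columns (mat 1) p) ** select_columns (mat 1) p = mat 1"
proof -
  have "(\<Sum>k\<in>UNIV. (if k = p i then 1 else 0) * (if k = p j then 1 else 0)) = (if i = j then 1 else (0::real))"
    for i j
    using assms by (simp add: if_distrib[of "\<lambda>x. x * _"] inj_eq cong: if_cong)
  then show ?thesis
    by (simp add: vec_eq_iff select_columns_def transpose_def matrix_matrix_mult_def mat_def)
qed

text \<open>Swapping the lengths of the components \<open>u = Q x\<close> and \<open>v = x - Q x\<close> gives the vector
  \<open>y = (\<bar>v\<bar>/\<bar>u\<bar>) u + (\<bar>u\<bar>/\<bar>v\<bar>) v\<close>, which has the norm of \<open>x\<close> and satisfies \<open>\<bar>Q y\<bar> = \<bar>v\<bar>\<close>.\<close>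

lemma spectral_norm_complementary_projection_le:
  fixes Q :: "real^'n^'n"
  assumes idem: "Q ** Q = Q" and "Q \<noteq> 0"
  shows "spectral_norm (mat 1 - Q) \<le> spectral_norm Q"
proof (rule spectral_norm_leI)
  fix x :: "real^'n"
  define u v where "u = Q *v x" and "v = x - Q *v x"
  have QQ: "Q *v (Q *v z) = Q *v z" for z
    by (simp add: matrix_vector_mul_assoc idem)
  have Qu: "Q *v u = u" and Qv: "Q *v v = 0" and x: "x = u + v"
    by (simp_all add: u_def v_def QQ matrix_vector_mult_diff_distrib)
  obtain z where z: "Q *v z \<noteq> 0"
    using \<open>Q \<noteq> 0\<close> by (metis matrix_eq matrix_vector_mult_0)
  \<comment> \<open>The vector \<open>Q *v z\<close> is nonzero and fixed by \<open>Q\<close>, which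
    forces the norm of \<open>Q\<close> to be at least 1.\<close>
  have "norm (Q *v z) \<le> spectral_norm Q * norm (Q *v z)"
    using norm_matrix_vector_mult_le[of Q "Q *v z"] by (simp add: QQ)
  then have ge1: "1 \<le> spectral_norm Q"
    using z by simp
  have "norm v \<le> spectral_norm Q * norm x"
  \<comment> \<open>The rescaling below divides by both lengths. If \<open>u = 0\<close> then
    \<open>v = x\<close> and \<open>ge1\<close> gives the bound; if \<open>v = 0\<close> the left
    side vanishes.\<close>
  proof (cases "u = 0 \<or> v = 0")
    case True
    then show ?thesis
      using ge1 mult_right_mono[of 1 "spectral_norm Q" "norm x"] by (auto simp: x)
  next
    case False
    define a where "a = norm v / norm u"
    define y where "y = a *\<^sub>R u + (1 / a) *\<^sub>R v"
    have a: "a > 0"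
      using False by (simp add: a_def)
    \<comment> \<open>The two scale factors are reciprocal, so the cross term is unchanged while the
      two squared lengths trade places.\<close>
    have "y \<bullet> y = a\<^sup>2 * (norm u)\<^sup>2 + 2 * (u \<bullet> v) + (1 / a)\<^sup>2 * (norm v)\<^sup>2"
      using a by (simp add: y_def inner_add_left inner_add_right inner_commute
          power2_norm_eq_inner power_divide) (simp add: power2_eq_square)
    also have "\<dots> = (norm v)\<^sup>2 + 2 * (u \<bullet> v) + (norm u)\<^sup>2"
      using False by (simp add: a_def power_divide)
    also have "\<dots> = x \<bullet> x"
      by (simp add: x inner_add_left inner_add_right inner_commute power2_norm_eq_inner)
    finally have "norm y = norm x"
      by (simp add: norm_eq)
    moreover have "Q *v y = a *\<^sub>R u"
      by (simp add: y_def matrix_vector_right_distrib matrix_vector_mult_scaleR Qu Qv)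
    then have "norm (Q *v y) = norm v"
      using False by (simp add: a_def)
    ultimately show ?thesis
      using norm_matrix_vector_mult_le[of Q y] by simp
  qed
  then show "norm ((mat 1 - Q) *v x) \<le> spectral_norm Q * norm x"
    by (simp add: v_def matrix_vector_mult_diff_rdistrib)
qed

text \<open>Transposition preserves the first two Penrose conditions and exchanges the last
  two.\<close>

lemma is_pinv_transpose:
  assumes "is_pinv A X"
  shows "is_pinv (transpose A) (transpose X)"
  using assms unfolding is_pinv_def
  by (metis matrix_mul_assoc matrix_transpose_mul transpose_transpose)

text \<open>The explicit matrix \<open>?L\<close>, the inverse of the Gram matrix times
  \<open>transpose A\<close>, satisfies the Penrose conditions. This supplies the existence behind
  the definite description in \<open>pinv\<close>.\<close>

lemma full_column_rank_pinv:
  fixes A :: "real^'r^'q"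
  assumes "invertible (transpose A ** A)"
  shows "is_pinv A (pinv A)" and "pinv A ** A = mat 1"
proof -
  let ?M = "transpose A ** A"
  obtain X where X: "?M ** X = mat 1" "X ** ?M = mat 1"
    using assms by (auto simp: invertible_def)
  \<comment> \<open>Since \<open>?M\<close> is symmetric, \<open>transpose X\<close> is a left
    inverse and \<open>X\<close> a right inverse of it, so they coincide. Symmetry of
    \<open>X\<close> then makes \<open>A ** ?L\<close> symmetric.\<close>
  have "transpose X ** ?M = mat 1"
    using arg_cong[OF X(1), of transpose] by (simp add: matrix_transpose_mul)
  then have sym: "transpose X = X"
    by (metis X(1) matrix_mul_assoc matrix_mul_lid matrix_mul_rid)
  let ?L = "X ** transpose A"
  have LA: "?L ** A = mat 1"
    using X(2) by (simp add: matrix_mul_assoc)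
  have "A ** ?L ** A = A"
    by (metis LA matrix_mul_assoc matrix_mul_rid)
  moreover have "transpose (A ** ?L) = A ** ?L"
    by (simp add: matrix_transpose_mul sym matrix_mul_assoc)
  ultimately have L: "is_pinv A ?L"
    by (simp add: is_pinv_def LA)
  then show "is_pinv A (pinv A)" and "pinv A ** A = mat 1"
    using LA by (simp_all add: pinv_eqI)
qed

text \<open>Reconciles \<open>pinv (transpose Y ** S)\<close> in the right projector with
  \<open>pinv (transpose S ** Y)\<close> in \<open>\<eta>\<^sub>s\<close>.\<close>

lemma pinv_transpose:
  assumes "invertible (transpose A ** A)"
  shows "pinv (transpose A) = transpose (pinv A)"
  by (intro pinv_eqI is_pinv_transpose full_column_rank_pinv(1) assms)

text \<open>The outer factors \<open>U\<close> and \<open>transpose P\<close> of \<open>Q\<close>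
  have norm at most 1, so the pseudoinverse controls the norm of \<open>Q\<close>. The lemma serves
  \<open>U\<close>, \<open>P\<close> directly and \<open>Y\<close>, \<open>S\<close> after
  transposition.\<close>

lemma oblique_projector:
  fixes U :: "real^'r^'n" and P :: "real^'q^'n"
  assumes U: "transpose U ** U = mat 1" and P: "transpose P ** P = mat 1"
    and inv: "invertible (transpose (transpose P ** U) ** (transpose P ** U))"
    and Q: "Q = U ** pinv (transpose P ** U) ** transpose P"
  shows "Q ** U = U"
    and "1 \<le> spectral_norm (pinv (transpose P ** U))"
    and "spectral_norm Q \<le> spectral_norm (pinv (transpose P ** U))"
    and "spectral_norm (mat 1 - Q) \<le> spectral_norm (pinv (transpose P ** U))"
proof -
  \<comment> \<open>\<open>?e\<close> is a unit vector at an arbitrary index. It witnesses that the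
    identity has norm at least 1 and that \<open>U\<close> is nonzero.\<close>
  let ?L = "pinv (transpose P ** U)" and ?e = "axis undefined 1 :: real^'r"
  have left_inv: "?L ** (transpose P ** U) = mat 1"
    by (rule full_column_rank_pinv(2)[OF inv])
  then show QU: "Q ** U = U"
    unfolding Q by (metis matrix_mul_assoc matrix_mul_rid)
  have nU: "spectral_norm U \<le> 1" and nP: "spectral_norm (transpose P) \<le> 1"
    using U P by (simp_all add: spectral_norm_orthonormal_columns_le spectral_norm_transpose)
  have "spectral_norm (transpose P ** U) \<le> 1"
    using spectral_norm_mult_le_mono[OF nP nU] by simp
  \<comment> \<open>Reading \<open>left_inv\<close> backwards, the identity is \<open>?L\<close>
    times a contraction.\<close>
  then have "spectral_norm (mat 1 :: real^'r^'r) \<le> spectral_norm ?L * 1"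
    unfolding left_inv[symmetric] by (intro spectral_norm_mult_le_mono order_refl)
  then show "1 \<le> spectral_norm ?L"
    using norm_matrix_vector_mult_le[of "mat 1" ?e] by simp
  show nQ: "spectral_norm Q \<le> spectral_norm ?L"
    using spectral_norm_mult_le_mono[OF spectral_norm_mult_le_mono[OF nU order_refl] nP, of ?L]
    by (simp add: Q)
  have "U \<noteq> 0"
    using norm_orthonormal_columns[OF U, of ?e] by auto
  then have "Q \<noteq> 0"
    using QU by auto
  moreover have "Q ** Q = Q"
    by (metis Q QU matrix_mul_assoc)
  ultimately show "spectral_norm (mat 1 - Q) \<le> spectral_norm ?L"
    using spectral_norm_complementary_projection_le nQ by fastforce
qed

theorem theorem3:
  fixes V :: "real^'s^'n"
    and U :: "real^'r^'n"
    and Y :: "real^'r^'s"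
    and p :: "'q::finite \<Rightarrow> 'n"
    and s :: "'q::finite \<Rightarrow> 's"
    and P :: "real^'q^'n"
    and S :: "real^'q^'s"
    and PU_obl :: "real^'n^'n"
    and PY_obl :: "real^'s^'s"
    and \<eta>\<^sub>p \<eta>\<^sub>s \<epsilon>\<^sub>f \<sigma> :: real
  assumes "CARD('r) \<le> CARD('q)"
    and "CARD('q) \<le> min CARD('n) CARD('s)"
    and "transpose U ** U = mat 1"
    and "transpose Y ** Y = mat 1"
    and "inj p"
    and "inj s"
    and "P = select_columns (mat 1) p"
    and "S = select_columns (mat 1) s"
    and "invertible (transpose (transpose P ** U) ** (transpose P ** U))"
    and "invertible (transpose (transpose S ** Y) ** (transpose S ** Y))"
    and "PU_obl = U ** pinv (transpose P ** U) ** transpose P"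
    and "PY_obl = S ** pinv (transpose Y ** S) ** transpose Y"
    and "\<eta>\<^sub>p = spectral_norm (pinv (transpose P ** U))"
    and "\<eta>\<^sub>s = spectral_norm (pinv (transpose S ** Y))"
    and "\<epsilon>\<^sub>f = min (\<eta>\<^sub>p * (1 + \<eta>\<^sub>s)) (\<eta>\<^sub>s * (1 + \<eta>\<^sub>p)) - 1"
    and "\<sigma> = max (spectral_norm (V - U ** transpose U ** V))
                  (spectral_norm (V - V ** Y ** transpose Y))"
  shows "0 \<le> \<epsilon>\<^sub>f \<and> spectral_norm (V - PU_obl ** V ** PY_obl) \<le> (1 + \<epsilon>\<^sub>f) * \<sigma>"
proof -
  have P: "transpose P ** P = mat 1" and S: "transpose S ** S = mat 1"
    using assms(5-8) by (simp_all add: select_columns_orthonormal)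
  let ?QU = "mat 1 - PU_obl" and ?QY = "mat 1 - PY_obl"
  let ?EU = "V - U ** transpose U ** V" and ?EY = "V - V ** Y ** transpose Y"
  \<comment> \<open>Transposing brings the right projector into the shape of the left one, so that
    \<open>oblique_projector\<close> applies to it.\<close>
  have "transpose PY_obl = Y ** pinv (transpose S ** Y) ** transpose S"
    using pinv_transpose[OF assms(10)]
    by (simp add: assms(12) matrix_transpose_mul matrix_mul_assoc)
  note ob_U = oblique_projector[OF assms(3) P assms(9) assms(11), folded assms(13)]
    and ob_Y = oblique_projector[OF assms(4) S assms(10) this, folded assms(14)]
  have PY: "spectral_norm PY_obl \<le> \<eta>\<^sub>s"
    using ob_Y(3) by (simp add: spectral_norm_transpose)
  have "transpose ?QY = mat 1 - transpose PY_obl"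
    by (simp add: transpose_def mat_def vec_eq_iff eq_commute)
  then have QY: "spectral_norm ?QY \<le> \<eta>\<^sub>s"
    using ob_Y(4) by (metis spectral_norm_transpose)
  \<comment> \<open>Hence \<open>?QY\<close> is annihilated by \<open>transpose Y\<close> from the
    left, and \<open>V ** Y ** transpose Y\<close> can be subtracted from \<open>V\<close> in front
    of \<open>?QY\<close>.\<close>
  have "transpose Y ** PY_obl = transpose Y"
    using arg_cong[OF ob_Y(1), of transpose] by (simp add: matrix_transpose_mul)
  then have "V ** Y ** transpose Y ** PY_obl = V ** Y ** transpose Y"
    by (metis matrix_mul_assoc)
  then have EY: "V ** ?QY = ?EY ** ?QY"
    by (simp add: matrix_diff_ldistrib matrix_diff_rdistrib)
  have "PU_obl ** (U ** transpose U ** V) = U ** transpose U ** V"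
    by (simp add: matrix_mul_assoc ob_U(1))
  then have EU: "?QU ** V = ?QU ** ?EU"
    by (simp add: matrix_diff_ldistrib matrix_diff_rdistrib)
  have \<sigma>: "spectral_norm ?EU \<le> \<sigma>" "spectral_norm ?EY \<le> \<sigma>"
    by (simp_all add: assms(16))
  have U_err: "spectral_norm (?QU ** V) \<le> \<eta>\<^sub>p * \<sigma>"
    unfolding EU by (rule spectral_norm_mult_le_mono[OF ob_U(4) \<sigma>(1)])
  have Y_err: "spectral_norm (V ** ?QY) \<le> \<sigma> * \<eta>\<^sub>s"
    unfolding EY by (rule spectral_norm_mult_le_mono[OF \<sigma>(2) QY])
  let ?E = "V - PU_obl ** V ** PY_obl"
  have "?E = ?QU ** V + PU_obl ** (V ** ?QY)"
    by (simp add: matrix_diff_ldistrib matrix_diff_rdistrib matrix_mul_assoc)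
  then have "spectral_norm ?E \<le> spectral_norm (?QU ** V) + spectral_norm (PU_obl ** (V ** ?QY))"
    by (simp only: spectral_norm_triangle)
  also have "\<dots> \<le> \<eta>\<^sub>p * \<sigma> + \<eta>\<^sub>p * (\<sigma> * \<eta>\<^sub>s)"
    by (intro add_mono U_err spectral_norm_mult_le_mono[OF ob_U(3) Y_err])
  finally have bound1: "spectral_norm ?E \<le> \<eta>\<^sub>p * (1 + \<eta>\<^sub>s) * \<sigma>"
    by (simp add: algebra_simps)
  have "?E = V ** ?QY + ?QU ** V ** PY_obl"
    by (simp add: matrix_diff_ldistrib matrix_diff_rdistrib)
  then have "spectral_norm ?E \<le> spectral_norm (V ** ?QY) + spectral_norm (?QU ** V ** PY_obl)"
    by (simp only: spectral_norm_triangle)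
  also have "\<dots> \<le> \<sigma> * \<eta>\<^sub>s + \<eta>\<^sub>p * \<sigma> * \<eta>\<^sub>s"
    by (intro add_mono Y_err spectral_norm_mult_le_mono[OF U_err PY])
  finally have bound2: "spectral_norm ?E \<le> \<eta>\<^sub>s * (1 + \<eta>\<^sub>p) * \<sigma>"
    by (simp add: algebra_simps)
  \<comment> \<open>Both \<open>\<eta>\<^sub>p\<close> and \<open>\<eta>\<^sub>s\<close> are at
    least 1, so either candidate for the minimum is at least 1, whence
    \<open>\<epsilon>\<^sub>f\<close> is nonnegative. The form \<open>1 * 1\<close> lets
    \<open>mult_mono\<close> compare factor by factor.\<close>
  have "1 * 1 \<le> \<eta>\<^sub>p * (1 + \<eta>\<^sub>s)" "1 * 1 \<le> \<eta>\<^sub>s * (1 + \<eta>\<^sub>p)"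
    using ob_U(2) ob_Y(2) by (intro mult_mono; simp)+
  then show ?thesis
    using bound1 bound2 by (simp add: assms(15) min_def)
qed

end
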